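(* Suppose there exists an attack detection and localization algorithm generating an estimated support prior $\hat{\mathcal{T}}^c$ (the complement of an estimated attack support $\hat{\mathcal{T}}\subseteq\{1,\dots,m\}$) that satisfies the uncertainty model described in the context. Let $\eta\in(0,1)$, and let $\hat{\mathcal{T}}_\eta^c$ be the pruned support prior obtained from $\hat{\mathcal{T}}^c$ through the pruning algorithm described in the context. Then the precision $\mathsf{PPV}_\eta$ of the pruned support prior $\hat{\mathcal{T}}_\eta^c$ satisfies $$\Pr\{\mathsf{PPV}_\eta=1\}\ge\eta .$$
   Context: Indicator vectors: for $\mathcal{S}\subseteq\{1,\dots,m\}$ the indicator vector has $i$-th entry $0$ if $i\in\mathcal{S}$ and $1$ otherwise; complements are taken in $\{1,\dots,m\}$. $\mathcal{T}$ is the true (unknown) attack support with indicator vector $\mathbf{q}$, and $\hat{\mathcal{T}}$ is the estimated support produced by the attack detection and localization algorithm, with indicator vector $\hat{\mathbf{q}}$. Uncertainty model (Poisson binomial): $\mathbf{q}_i=\epsilon_i\hat{\mathbf{q}}_i+(1-\epsilon_i)(1-\hat{\mathbf{q}}_i)$ for $i=1,\dots,m$, where the $\epsilon_i$ (the agreement between the actual $\mathcal{T}^c$ and the estimated $\hat{\mathcal{T}}^c$ at $i$) are independent Bernoulli random variables with $\Pr\{\epsilon_i=1\}=\mathbb{E}(\epsilon_i)=\mathbf{p}_i\in(0,1)$; $\hat{\mathbf{q}}$ is given and probabilities are over the $\epsilon_i$. Pruning algorithm with parameter $\eta\in(0,1)$: (I) compute $$l_\eta=\max\Big\{|\mathcal{I}|\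 :\ \prod_{i\in\mathcal{I}}\mathbf{p}_i\ge\eta,\ \mathcal{I}\subseteq\hat{\mathcal{T}}^c\Big\};$$ (II) let $\hat{\mathcal{T}}_\eta^c$ be the set of the first $l_\eta$ indices obtained by sorting $\{1,\dots,m\}$ in descending order of the entries $\mathbf{p}_i\hat{\mathbf{q}}_i$. Precision of the pruned prior: $$\mathsf{PPV}_\eta=\frac{\sum_{i\in\hat{\mathcal{T}}_\eta^c}\epsilon_i}{|\hat{\mathcal{T}}_\eta^c|}.$$ *)

theory Defs
  imports "HOL-Probability.Probability"
begin

definition ind_vec :: "nat set \<Rightarrow> nat \<Rightarrow> real" where
  "ind_vec S i = (if i \<in> S then 0 else 1)"

definition bernoulli_rv :: "'a measure \<Rightarrow> ('a \<Rightarrow> real) \<Rightarrow> real \<Rightarrow> bool" where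
  "bernoulli_rv M X r \<longleftrightarrow>
     X \<in> borel_measurable M \<and> X \<in> space M \<rightarrow> {0, 1} \<and> \<P>(\<omega> in M. X \<omega> = 1) = r"

text \<open>The estimate \<open>That\<close> is given, hence deterministic. The actual support \<open>T\<close> is random,
  its indicator vector being tied to that of \<open>That\<close> by the agreement variables \<open>eps\<close>.
  Vectors of length \<open>m\<close> are functions of which only the values on \<open>{1..m}\<close> matter.\<close>

locale uncertainty_model = prob_space M
  for M :: "'a measure" +
  fixes m :: nat
    and T :: "'a \<Rightarrow> nat set"
    and That :: "nat set"
    and eps :: "nat \<Rightarrow> 'a \<Rightarrow> real"
    and p :: "nat \<Rightarrow> real"
  assumes T_subset: "\<And>\<omega>. \<omega> \<in> space M \<Longrightarrow> T \<omega> \<subseteq> {1..m}"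
    and That_subset: "That \<subseteq> {1..m}"
    and p_range: "\<And>i. i \<in> {1..m} \<Longrightarrow> p i \<in> {0<..<1}"
    and eps_bernoulli: "\<And>i. i \<in> {1..m} \<Longrightarrow> bernoulli_rv M (eps i) (p i)"
    and eps_indep: "indep_vars (\<lambda>_. borel) eps {1..m}"
    and model: "\<And>i \<omega>. i \<in> {1..m} \<Longrightarrow> \<omega> \<in> space M \<Longrightarrow>
      ind_vec (T \<omega>) i = eps i \<omega> * ind_vec That i + (1 - eps i \<omega>) * (1 - ind_vec That i)"

definition prune_size :: "nat \<Rightarrow> nat set \<Rightarrow> (nat \<Rightarrow> real) \<Rightarrow> real \<Rightarrow> nat" where
  "prune_size m That p \<eta> = Max {card I | I. (\<Prod>i\<in>I. p i) \<ge> \<eta> \<and> I \<subseteq> {1..m} - That}"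

definition descending_sorting :: "nat \<Rightarrow> (nat \<Rightarrow> real) \<Rightarrow> nat list \<Rightarrow> bool" where
  "descending_sorting m v xs \<longleftrightarrow>
     distinct xs \<and> set xs = {1..m} \<and> sorted_wrt (\<lambda>i j. v i \<ge> v j) xs"

text \<open>The order of indices with equal entries is left open, so pruning is a relation:
  \<open>S\<close> (the complement of the pruned support) is a possible output of the algorithm.\<close>

definition is_pruned_prior :: "nat \<Rightarrow> nat set \<Rightarrow> (nat \<Rightarrow> real) \<Rightarrow> real \<Rightarrow> nat set \<Rightarrow> bool" where
  "is_pruned_prior m That p \<eta> S \<longleftrightarrow>
     (\<exists>xs. descending_sorting m (\<lambda>i. p i * ind_vec That i) xs \<and>
           S = set (take (prune_size m That p \<eta>) xs))"

text \<open>If no index survives the pruning, the defining ratio is \<open>0 / 0\<close>. The precision of the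
  empty prior is taken to be \<open>1\<close>, as it contains no wrong index; the division convention
  \<open>0 / 0 = 0\<close> of the library would give \<open>0\<close> instead.\<close>

definition PPV :: "(nat \<Rightarrow> 'a \<Rightarrow> real) \<Rightarrow> nat set \<Rightarrow> 'a \<Rightarrow> real" where
  "PPV eps S \<omega> = (if S = {} then 1 else (\<Sum>i\<in>S. eps i \<omega>) / real (card S))"

end

theory Submission
  imports Defs
begin

text \<open>The precision is \<open>1\<close> as soon as all agreement variables indexed by \<open>S\<close> equal \<open>1\<close>, and by
  independence this has probability \<open>\<Prod>i\<in>S. p i\<close>. So it suffices to bound this product below by
  \<open>\<eta>\<close>. Let \<open>I\<close> attain the maximum that defines the pruning size, so that
  \<open>(\<Prod>i\<in>I. p i) \<ge> \<eta>\<close> and \<open>card I = card S\<close>. The set \<open>S\<close> collects the largest values of the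
  weights \<open>v i = p i * ind_vec That i\<close>, and among the sets of a given size such a set maximises
  the product (lemma \<open>prod_le_prod_dominating_set\<close>). The weights agree with \<open>p\<close> on
  \<open>I\<close>, which avoids \<open>That\<close>, and are at most \<open>p\<close> everywhere; hence
  \<open>(\<Prod>i\<in>S. p i) \<ge> (\<Prod>i\<in>S. v i) \<ge> (\<Prod>i\<in>I. v i) = (\<Prod>i\<in>I. p i) \<ge> \<eta>\<close>.\<close>

text \<open>The common part of the two sets contributes the same factor to both products. What
  remains on either side has equal size, so it can be matched up, and each factor
  from \<open>I\<close> is at most its partner from \<open>S\<close>.\<close>

lemma prod_le_prod_dominating_set:
  fixes v :: "'i \<Rightarrow> real"
  assumes "finite S" "finite I" and card: "card I = card S"
    and nonneg: "\<And>i. i \<in> I \<union> S \<Longrightarrow> 0 \<le> v i"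
    and dom: "\<And>i j. i \<in> S \<Longrightarrow> j \<in> I - S \<Longrightarrow> v j \<le> v i"
  shows "prod v I \<le> prod v S"
proof -
  have "card (I - S) = card (S - I)"
    using assms by (simp add: card_Diff_subset_Int Int_commute)
  then obtain f where f: "bij_betw f (I - S) (S - I)"
    using assms(1,2) by (metis bij_betw_iff_card finite_Diff)
  have "prod v (I - S) \<le> prod (\<lambda>j. v (f j)) (I - S)"
  proof (rule prod_mono)
    fix j assume j: "j \<in> I - S"
    then have "f j \<in> S" using f by (auto dest: bij_betwE)
    then show "0 \<le> v j \<and> v j \<le> v (f j)" using j nonneg dom by auto
  qed
  also have "\<dots> = prod v (S - I)"
    by (rule prod.reindex_bij_betw[OF f])
  finally have diff: "prod v (I - S) \<le> prod v (S - I)" .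
  have "prod v I = prod v (I \<inter> S) * prod v (I - S)"
    using prod.Int_Diff[OF assms(2)] .
  also have "\<dots> \<le> prod v (S \<inter> I) * prod v (S - I)"
    using diff nonneg by (auto simp: Int_commute intro!: mult_left_mono prod_nonneg)
  also have "\<dots> = prod v S"
    using prod.Int_Diff[OF assms(1), of v I] by simp
  finally show ?thesis .
qed

lemma descending_sorting_take_dominates:
  assumes "descending_sorting m v xs" "i \<in> set (take l xs)" "j \<in> {1..m} - set (take l xs)"
  shows "v j \<le> v i"
proof -
  have "j \<in> set xs" using assms(1,3) by (auto simp: descending_sorting_def)
  then have "j \<in> set (drop l xs)"
    using assms(3) by (metis Diff_iff Un_iff append_take_drop_id set_append)
  moreover have "sorted_wrt (\<lambda>i j. v i \<ge> v j) (take l xs @ drop l xs)"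
    using assms(1) by (simp add: descending_sorting_def)
  ultimately show ?thesis
    using assms(2) unfolding sorted_wrt_append by blast
qed

text \<open>The empty set is admissible because \<open>\<eta> \<le> 1\<close>, so the maximum ranges over a nonempty
  finite set and is attained.\<close>

lemma prune_size_attained:
  assumes "\<eta> \<le> 1"
  obtains I where "I \<subseteq> {1..m} - That" "\<eta> \<le> (\<Prod>i\<in>I. p i)" "card I = prune_size m That p \<eta>"
proof -
  let ?C = "{card I | I. (\<Prod>i\<in>I. p i) \<ge> \<eta> \<and> I \<subseteq> {1..m} - That}"
  have "?C \<subseteq> card ` Pow {1..m}" by auto
  then have "finite ?C" by (rule finite_subset) simp
  moreover have "card {} \<in> ?C" using assms by force
  ultimately have "Max ?C \<in> ?C" by (intro Max_in) auto
  then obtain I where "Max ?C = card I" "\<eta> \<le> (\<Prod>i\<in>I. p i)" "I \<subseteq> {1..m} - That"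
    by auto
  then show thesis using that by (simp add: prune_size_def)
qed

lemma is_pruned_prior_subset:
  assumes "is_pruned_prior m That p \<eta> S"
  shows "S \<subseteq> {1..m}"
  using assms by (auto simp: is_pruned_prior_def descending_sorting_def dest: in_set_takeD)

lemma prod_pruned_prior_ge:
  assumes p: "\<And>i. i \<in> {1..m} \<Longrightarrow> 0 \<le> p i" and "\<eta> \<le> 1"
    and S: "is_pruned_prior m That p \<eta> S"
  shows "\<eta> \<le> (\<Prod>i\<in>S. p i)"
proof -
  define v where "v = (\<lambda>i. p i * ind_vec That i)"
  obtain I where I: "I \<subseteq> {1..m} - That" "\<eta> \<le> (\<Prod>i\<in>I. p i)" "card I = prune_size m That p \<eta>"
    using prune_size_attained[OF \<open>\<eta> \<le> 1\<close>] .
  obtain xs where xs: "descending_sorting m v xs"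
    and S_eq: "S = set (take (prune_size m That p \<eta>) xs)"
    using S unfolding is_pruned_prior_def v_def by blast
  have "I \<subseteq> {1..m}" using I(1) by blast
  then have "finite I" by (rule finite_subset) simp
  have dist: "distinct xs" and set_xs: "set xs = {1..m}"
    using xs by (auto simp: descending_sorting_def)
  have "card I \<le> length xs"
    using card_mono[OF _ \<open>I \<subseteq> {1..m}\<close>] distinct_card[OF dist] set_xs by simp
  \<comment> \<open>Truncating \<open>xs\<close> therefore does not run past its end.\<close>
  then have card_S: "card I = card S"
    using dist I(3) unfolding S_eq by (simp add: distinct_card)
  note S_sub = is_pruned_prior_subset[OF S]
  have v: "0 \<le> v i" "v i \<le> p i" if "i \<in> {1..m}" for i
    using p[OF that] by (auto simp: v_def ind_vec_def)
  have "\<eta> \<le> (\<Prod>i\<in>I. p i)" by (fact I(2))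
  also have "\<dots> = prod v I"
    using I(1) by (intro prod.cong) (auto simp: v_def ind_vec_def)
  also have "\<dots> \<le> prod v S"
  proof (rule prod_le_prod_dominating_set)
    show "v j \<le> v i" if "i \<in> S" "j \<in> I - S" for i j
      using descending_sorting_take_dominates[OF xs] that \<open>I \<subseteq> {1..m}\<close> unfolding S_eq by blast
  qed (use \<open>finite I\<close> card_S v(1) S_sub \<open>I \<subseteq> {1..m}\<close> in \<open>auto simp: S_eq\<close>)
  also have "\<dots> \<le> (\<Prod>i\<in>S. p i)"
    using v S_sub by (intro prod_mono) blast
  finally show ?thesis .
qed

lemma (in prob_space) prob_all_ones:
  fixes X :: "'i \<Rightarrow> 'a \<Rightarrow> real"
  assumes indep: "indep_vars (\<lambda>_. borel) X K" and J: "J \<subseteq> K" "finite J"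
  shows "\<P>(\<omega> in M. \<forall>i\<in>J. X i \<omega> = 1) = (\<Prod>i\<in>J. \<P>(\<omega> in M. X i \<omega> = 1))"
proof (cases "J = {}")
  case True
  then show ?thesis by (simp add: prob_space)
next
  case False
  have "{\<omega> \<in> space M. \<forall>i\<in>J. X i \<omega> = 1} = (\<Inter>i\<in>J. X i -` {1} \<inter> space M)"
    using False by auto
  moreover have "prob (\<Inter>i\<in>J. X i -` {1} \<inter> space M) = (\<Prod>i\<in>J. prob (X i -` {1} \<inter> space M))"
    using False J by (intro indep_varsD[OF indep]) auto
  moreover have "X i -` {1} \<inter> space M = {\<omega> \<in> space M. X i \<omega> = 1}" for i
    by auto
  ultimately show ?thesis by simp
qed

lemma PPV_eq_1:
  assumes "finite S" "\<And>i. i \<in> S \<Longrightarrow> eps i \<omega> = 1"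
  shows "PPV eps S \<omega> = 1"
  using assms by (simp add: PPV_def)

theorem theorem2:
  fixes M :: "'a measure" and m :: nat
    and T :: "'a \<Rightarrow> nat set" and That :: "nat set"
    and eps :: "nat \<Rightarrow> 'a \<Rightarrow> real" and p :: "nat \<Rightarrow> real"
    and \<eta> :: real and S :: "nat set"
  assumes "uncertainty_model M m T That eps p"
    and "\<eta> \<in> {0<..<1}"
    and "is_pruned_prior m That p \<eta> S"
  shows "\<P>(\<omega> in M. PPV eps S \<omega> = 1) \<ge> \<eta>"
proof -
  interpret uncertainty_model M m T That eps p by fact
  note S_sub = is_pruned_prior_subset[OF assms(3)]
  then have "finite S" by (rule finite_subset) simp
  have [measurable]: "eps i \<in> borel_measurable M" if "i \<in> S" for i
    using eps_bernoulli[of i] S_sub that by (auto simp: bernoulli_rv_def)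
  have [measurable]: "PPV eps S \<in> borel_measurable M"
    unfolding PPV_def[abs_def] by measurable
  have "\<eta> \<le> (\<Prod>i\<in>S. p i)"
    using assms(2) p_range by (intro prod_pruned_prior_ge[OF _ _ assms(3)]) (auto simp: less_imp_le)
  also have "\<dots> = (\<Prod>i\<in>S. \<P>(\<omega> in M. eps i \<omega> = 1))"
    using eps_bernoulli S_sub by (intro prod.cong) (auto simp: bernoulli_rv_def)
  also have "\<dots> = \<P>(\<omega> in M. \<forall>i\<in>S. eps i \<omega> = 1)"
    by (rule prob_all_ones[OF eps_indep S_sub \<open>finite S\<close>, symmetric])
  also have "\<dots> \<le> \<P>(\<omega> in M. PPV eps S \<omega> = 1)"
  proof (rule finite_measure_mono)
    show "{\<omega> \<in> space M. \<forall>i\<in>S. eps i \<omega> = 1} \<subseteq> {\<omega> \<in> space M. PPV eps S \<omega> = 1}"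
    proof (intro subsetI CollectI conjI)
      fix \<omega> assume \<omega>: "\<omega> \<in> {\<omega> \<in> space M. \<forall>i\<in>S. eps i \<omega> = 1}"
      then show "\<omega> \<in> space M" by simp
      show "PPV eps S \<omega> = 1" using \<omega> by (intro PPV_eq_1[OF \<open>finite S\<close>]) simp
    qed
    show "{\<omega> \<in> space M. PPV eps S \<omega> = 1} \<in> events" by measurable
  qed
  finally show ?thesis .
qed

end
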